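(* Let $c>0$ and $\Delta=(0,c]$, and let $F,G$ be distributions on $\mathbb R$. Suppose that $F\in\mathcal S_\Delta\cap\mathcal D_\Delta$, $G\in\mathcal L_\Delta$ and $G(x+\Delta)\asymp F(x+\Delta)$ as $x\to\infty$. Then $G\in\mathcal S_\Delta$. In particular, if $F\in\mathcal S_\Delta\cap\mathcal D_\Delta$ and $G(x+\Delta)\sim\kappa F(x+\Delta)$ as $x\to\infty$ for some constant $\kappa>0$, then $G\in\mathcal S_\Delta$. Moreover, if additionally $G$ is a distribution on $\mathbb R_+=[0,\infty)$, then these assertions hold without the assumption $F\in\mathcal D_\Delta$ (i.e. assuming only $F\in\mathcal S_\Delta$ for the distribution $F$ on $\mathbb R$).
   Context: For $\Delta=(0,c]$ and a distribution $F$ on $\mathbb R$, $F(x+\Delta):=F((x,x+c])$. $F^{*n}$ is the $n$-fold convolution. $\alpha(x)\sim\beta(x)$ means $\alpha(x)/\beta(x)\to1$ as $x\to\infty$; $\alpha(x)\asymp\beta(x)$ means $0<\liminf_{x\to\infty}\alpha(x)/\beta(x)\le\limsup_{x\to\infty}\alpha(x)/\beta(x)<\infty$. A non-negative measurable function $\alpha$ belongs to $\mathcal L$ if there is $x_0>0$ with $\alpha(x)>0$ for $x\ge x_0$ and, for every fixed $y>0$, $\alpha(x+y)\sim\alpha(x)$. $F\in\mathcal L_\Delta$ if $x\mapsto F(x+\Delta)$ is in $\mathcal L$; $F\in\mathcal S_\Delta$ if $F\in\mathcal L_\Delta$ and $F^{*2}(x+\Delta)\sim 2F(x+\Delta)$.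 A function $\alpha:\mathbb R\to\mathbb R_+$ is almost decreasing if there exist $x_0>0$ and $K>0$ such that $\alpha(x+y)\le K\alpha(x)$ for all $x>x_0$, $y>0$. $F\in\mathcal D_\Delta$ if $x\mapsto F(x+\Delta)$ is almost decreasing. *)

theory Defs
  imports "HOL-Probability.Probability" "HOL-Library.Landau_Symbols"
begin

(* Distributions on the real line are Borel probability measures (locale real_distribution).
   The library relation f \<sim>[at_top] g reads 0 / 0 as 1. It is only used below with a right-hand
   side that is eventually positive, where it says exactly that f x / g x tends to 1. *)

text \<open>\<open>F(x + \<Delta>)\<close> for \<open>\<Delta> = (0, c]\<close>.\<close>

definition delta_prob :: "real \<Rightarrow> real measure \<Rightarrow> real \<Rightarrow> real" where
  "delta_prob c F x = measure F {x<..x + c}"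

definition weakly_equiv :: "(real \<Rightarrow> real) \<Rightarrow> (real \<Rightarrow> real) \<Rightarrow> bool"  (infix \<open>\<asymp>\<close> 50) where
  "\<alpha> \<asymp> \<beta> \<longleftrightarrow>
     0 < Liminf at_top (\<lambda>x. ereal (\<alpha> x / \<beta> x)) \<and>
     Liminf at_top (\<lambda>x. ereal (\<alpha> x / \<beta> x)) \<le> Limsup at_top (\<lambda>x. ereal (\<alpha> x / \<beta> x)) \<and>
     Limsup at_top (\<lambda>x. ereal (\<alpha> x / \<beta> x)) < \<infinity>"

definition class_L :: "(real \<Rightarrow> real) set" where
  "class_L = {\<alpha>. \<alpha> \<in> borel_measurable borel \<and> (\<forall>x. 0 \<le> \<alpha> x) \<and>
     (\<exists>x0>0. \<forall>x\<ge>x0. 0 < \<alpha> x) \<and>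
     (\<forall>y>0. (\<lambda>x. \<alpha> (x + y)) \<sim>[at_top] \<alpha>)}"

definition almost_decreasing :: "(real \<Rightarrow> real) \<Rightarrow> bool" where
  "almost_decreasing \<alpha> \<longleftrightarrow> (\<forall>x. 0 \<le> \<alpha> x) \<and>
     (\<exists>x0>0. \<exists>K>0. \<forall>x>x0. \<forall>y>0. \<alpha> (x + y) \<le> K * \<alpha> x)"

definition L_delta :: "real \<Rightarrow> real measure set" where
  "L_delta c = {F. real_distribution F \<and> delta_prob c F \<in> class_L}"

definition S_delta :: "real \<Rightarrow> real measure set" where
  "S_delta c = {F \<in> L_delta c.
     delta_prob c (convolution F F) \<sim>[at_top] (\<lambda>x. 2 * delta_prob c F x)}"

definition D_delta :: "real \<Rightarrow> real measure set" where
  "D_delta c = {F. real_distribution F \<and> almost_decreasing (delta_prob c F)}"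

end

theory Submission
  imports Defs
begin

text \<open>
  For independent \<open>X\<close>, \<open>Y\<close> with distribution \<open>F\<close> and \<open>x \<ge> 2 h\<close>, the event \<open>X + Y \<in> x + \<Delta>\<close> splits into
  three disjoint parts: \<open>Y \<le> h\<close>; \<open>X \<le> h\<close>; both summands exceed \<open>h\<close>. The first two have the same
  probability, the integral of \<open>F(x - v + \<Delta>)\<close> over \<open>v \<le> h\<close>. Relative to \<open>F(x + \<Delta>)\<close> it
  tends to \<open>F((-\<infinity>, h])\<close> whenever dominated convergence applies. Hence, up to this domination,
  \<open>F \<in> S_delta c\<close> means that the third part is negligible relative to \<open>F(x + \<Delta>)\<close> as first
  \<open>x\<close> and then \<open>h\<close> tend to infinity.

  The proof rests on three observations.

  \<^item> \<^emph>\<open>Subexponentiality makes the third part negligible\<close>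
    (\<open>S_delta_tails_negligible\<close>). A lower bound for the first two parts suffices, so the integral may
    be cut down to the bounded range \<open>-h < v \<le> h\<close>. There \<open>F(x - v + \<Delta>)\<close> is bounded by a
    multiple of \<open>F(x + \<Delta>)\<close>, because \<open>x - v + \<Delta>\<close> is covered by two of finitely many translates
    of \<open>x + \<Delta>\<close> (\<open>delta_prob_locally_bounded\<close>).

  \<^item> \<^emph>\<open>The third part is monotone in the local probabilities\<close> (\<open>conv_on_tails_compare\<close>). If
    \<open>G(t + \<Delta>) \<le> C F(t + \<Delta>)\<close> for \<open>t \<ge> h - c\<close>, then replacing \<open>G\<close> by \<open>F\<close> in one
    summand at a time costs a factor \<open>C\<close> each and lowers the threshold from \<open>h\<close> to \<open>h - c\<close>.

  \<^item> \<^emph>\<open>Conversely, a negligible third part gives subexponentiality once negative summands are dominated\<close>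
    (\<open>S_deltaI_tails_negligible\<close>). For \<open>G\<close> this domination is trivial when \<open>G\<close> lives on
    the half-line, and otherwise it is inherited from \<open>F \<in> D_delta c\<close>
    (\<open>left_domination_of_D_delta\<close>).

  The version with \<open>G(x + \<Delta>) \<sim> \<kappa> F(x + \<Delta>)\<close> follows, since that relation implies both weak
  equivalence and \<open>G \<in> L_delta c\<close>.
\<close>

section \<open>Consequences of long-tailedness\<close>

lemma delta_prob_nonneg [simp]: "0 \<le> delta_prob c F x"
  by (simp add: delta_prob_def)

lemma (in real_distribution) delta_prob_measurable: "delta_prob c M \<in> borel_measurable borel"
proof (cases "c \<ge> 0")
  case True
  have "delta_prob c M x = cdf M (x + c) - cdf M x" for x
    using True cdf_diff_eq[of x "x + c"] by (cases "c = 0") (simp_all add: delta_prob_def)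
  then have "delta_prob c M = (\<lambda>x. cdf M (x + c) - cdf M x)" by blast
  moreover have "cdf M \<in> borel_measurable borel"
    by (intro borel_measurable_mono monoI cdf_nondecreasing)
  moreover from this have "(\<lambda>x. cdf M (x + c)) \<in> borel_measurable borel"
    by measurable
  ultimately show ?thesis by simp
next
  case False
  then have "delta_prob c M = (\<lambda>x. 0)" by (auto simp: fun_eq_iff delta_prob_def)
  then show ?thesis by simp
qed

lemma filterlim_shift_at_top: "filterlim (\<lambda>x. x + d) at_top (at_top :: real filter)"
  using filterlim_tendsto_add_at_top[OF tendsto_const[of d] filterlim_ident]
  by (simp add: add.commute)

lemma class_L_eventually_pos:
  assumes "\<alpha> \<in> class_L"
  shows "eventually (\<lambda>x. 0 < \<alpha> x) at_top"
  using assms unfolding class_L_def by (auto simp: eventually_at_top_linorder)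

lemma asymp_equiv_iff_ratio:
  fixes \<alpha> \<beta> :: "real \<Rightarrow> real"
  assumes "eventually (\<lambda>x. 0 < \<beta> x) at_top"
  shows "\<alpha> \<sim>[at_top] \<beta> \<longleftrightarrow> ((\<lambda>x. \<alpha> x / \<beta> x) \<longlongrightarrow> 1) at_top"
  unfolding asymp_equiv_def
proof (rule tendsto_cong)
  show "\<forall>\<^sub>F x in at_top. (if \<alpha> x = 0 \<and> \<beta> x = 0 then 1 else \<alpha> x / \<beta> x) = \<alpha> x / \<beta> x"
    using assms by eventually_elim simp
qed

lemma class_L_shift:
  assumes "\<alpha> \<in> class_L"
  shows "((\<lambda>x. \<alpha> (x - y) / \<alpha> x) \<longlongrightarrow> 1) at_top"
proof -
  have pos: "eventually (\<lambda>x. 0 < \<alpha> x) at_top"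
    by (rule class_L_eventually_pos[OF assms])
  have right: "((\<lambda>x. \<alpha> (x + z) / \<alpha> x) \<longlongrightarrow> 1) at_top" if "z > 0" for z
  proof -
    have "(\<lambda>x. \<alpha> (x + z)) \<sim>[at_top] \<alpha>" using assms that by (simp add: class_L_def)
    then show ?thesis by (simp only: asymp_equiv_iff_ratio[OF pos])
  qed
  consider "y < 0" | "y = 0" | "y > 0" by linarith
  then show ?thesis
  proof cases
    case 1
    then show ?thesis using right[of "-y"] by simp
  next
    case 2
    have "eventually (\<lambda>x. \<alpha> (x - y) / \<alpha> x = 1) at_top"
      using pos by eventually_elim (simp add: 2)
    then show ?thesis by (rule tendsto_eventually)
  next
    case 3
    from filterlim_compose[OF right[OF 3] filterlim_shift_at_top[of "- y"]]
    have "((\<lambda>x. \<alpha> x / \<alpha> (x - y)) \<longlongrightarrow> 1) at_top" by simp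
    from tendsto_inverse[OF this] show ?thesis by simp
  qed
qed

text \<open>
  Local boundedness of \<open>\<alpha>(x - v) / \<alpha>(x)\<close> for a general \<open>\<alpha> \<in> class_L\<close> rests on the uniform convergence
  theorem. For local probabilities it is elementary: the interval \<open>x - v + \<Delta>\<close> lies in the union of
  two neighbouring members of the grid \<open>x - k c + \<Delta>\<close>, and for bounded \<open>v\<close> only finitely many
  \<open>k\<close> occur.
\<close>

lemma delta_prob_locally_bounded:
  assumes c: "c > 0" and F: "F \<in> L_delta c"
  shows "eventually (\<lambda>x. \<forall>v\<in>{-h..h}. delta_prob c F (x - v) \<le> 4 * delta_prob c F x) at_top"
proof -
  interpret real_distribution F using F by (simp add: L_delta_def)
  have L: "delta_prob c F \<in> class_L" using F by (simp add: L_delta_def)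
  define J where "J = {\<lceil>- h / c\<rceil> - 1 .. \<lceil>h / c\<rceil>}"
  have "eventually (\<lambda>x. delta_prob c F (x - of_int k * c) \<le> 2 * delta_prob c F x) at_top" for k
  proof -
    have "eventually (\<lambda>x. delta_prob c F (x - of_int k * c) / delta_prob c F x < 2) at_top"
      by (rule order_tendstoD(2)[OF class_L_shift[OF L]]) simp
    with class_L_eventually_pos[OF L] show ?thesis
      by eventually_elim (simp add: field_simps)
  qed
  then have "eventually (\<lambda>x. \<forall>k\<in>J. delta_prob c F (x - of_int k * c) \<le> 2 * delta_prob c F x) at_top"
    by (intro eventually_ball_finite) (auto simp: J_def)
  then show ?thesis
  proof eventually_elim
    case (elim x)
    show ?case
    proof
      fix v assume v: "v \<in> {-h..h}"
      \<comment> \<open>The left end point \<open>x - v\<close> lies in \<open>[x - k c, x - (k - 1) c)\<close>.\<close>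
      define k where "k = \<lceil>v / c\<rceil>"
      have "of_int k - 1 < v / c" "v / c \<le> of_int k"
        unfolding k_def by linarith+
      then have k: "(of_int k - 1) * c < v" "v \<le> of_int k * c"
        using c by (simp_all add: field_simps)
      have "- h / c \<le> v / c" "v / c \<le> h / c"
        using v c by (intro divide_right_mono; simp)+
      then have "\<lceil>- h / c\<rceil> \<le> k" "k \<le> \<lceil>h / c\<rceil>"
        unfolding k_def by (blast intro: ceiling_mono)+
      then have "k \<in> J" "k - 1 \<in> J"
        by (auto simp: J_def)
      have "delta_prob c F (x - v)
          \<le> measure F ({x - of_int k * c <.. x - of_int k * c + c} \<union>
                       {x - of_int (k - 1) * c <.. x - of_int (k - 1) * c + c})"
        unfolding delta_prob_def
        by (rule finite_measure_mono) (use k in \<open>auto simp: algebra_simps\<close>)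
      also have "\<dots> \<le> delta_prob c F (x - of_int k * c) + delta_prob c F (x - of_int (k - 1) * c)"
        unfolding delta_prob_def by (rule measure_Un_le) auto
      also have "\<dots> \<le> 4 * delta_prob c F x"
        using bspec[OF elim \<open>k \<in> J\<close>] bspec[OF elim \<open>k - 1 \<in> J\<close>] by simp
      finally show "delta_prob c F (x - v) \<le> 4 * delta_prob c F x" .
    qed
  qed
qed

section \<open>Restricted convolutions\<close>

text \<open>
  The local probability of a convolution with both summands confined. The sets are arguments because
  the contribution of one moderate summand (\<open>UNIV\<close> and a half-line to the left) and that of two large
  ones (two half-lines to the right) are estimated in different ways.
\<close>

definition conv_on :: "real \<Rightarrow> real measure \<Rightarrow> real measure \<Rightarrow> real set \<Rightarrow> real set \<Rightarrow> real \<Rightarrow> real"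
  where "conv_on c M N A B x =
    measure (M \<Otimes>\<^sub>M N) {(u, v). u \<in> A \<and> v \<in> B \<and> x < u + v \<and> u + v \<le> x + c}"

locale real_distribution_pair = M: real_distribution M + N: real_distribution N for M N
begin

sublocale pair_prob_space M N ..

lemma sets_pair: "sets (M \<Otimes>\<^sub>M N) = sets (borel \<Otimes>\<^sub>M borel)"
  by (rule sets_pair_measure_cong) simp_all

lemma strip_sets [measurable]:
  assumes [measurable]: "A \<in> sets borel" "B \<in> sets borel"
  shows "{(u, v). u \<in> A \<and> v \<in> B \<and> x < u + v \<and> u + v \<le> x + (c::real)} \<in> sets (M \<Otimes>\<^sub>M N)"
proof -
  have "{(u, v). u \<in> A \<and> v \<in> B \<and> x < u + v \<and> u + v \<le> x + c}
      = {p \<in> space (borel \<Otimes>\<^sub>M borel). fst p \<in> A \<and> snd p \<in> B \<and> x < fst p + snd p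
          \<and> fst p + snd p \<le> x + c}"
    by (auto simp: space_pair_measure)
  also have "\<dots> \<in> sets (borel \<Otimes>\<^sub>M borel)"
    by measurable
  finally show ?thesis
    by (simp only: sets_pair)
qed

lemma conv_on_swap:
  assumes [measurable]: "A \<in> sets borel" "B \<in> sets borel"
  shows "conv_on c M N A B x = conv_on c N M B A x"
proof -
  interpret swapped: real_distribution_pair N M ..
  let ?S = "{(u, v). u \<in> A \<and> v \<in> B \<and> x < u + v \<and> u + v \<le> x + c}"
  have "conv_on c M N A B x = measure (distr (N \<Otimes>\<^sub>M M) (M \<Otimes>\<^sub>M N) (\<lambda>(x, y). (y, x))) ?S"
    unfolding conv_on_def by (subst distr_pair_swap) simp
  also have "\<dots> = measure (N \<Otimes>\<^sub>M M) ((\<lambda>(x, y). (y, x)) -` ?S \<inter> space (N \<Otimes>\<^sub>M M))"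
    by (intro measure_distr measurable_pair_swap' strip_sets assms)
  also have "(\<lambda>(x, y). (y, x)) -` ?S \<inter> space (N \<Otimes>\<^sub>M M)
      = {(u, v). u \<in> B \<and> v \<in> A \<and> x < u + v \<and> u + v \<le> x + c}"
    by (auto simp: space_pair_measure add.commute)
  finally show ?thesis by (simp add: conv_on_def)
qed

lemma conv_on_eq_integral:
  assumes [measurable]: "A \<in> sets borel" "B \<in> sets borel"
  shows "conv_on c M N A B x = (\<integral>v. indicator B v * measure M (A \<inter> {x - v<..x - v + c}) \<partial>N)"
    and "integrable N (\<lambda>v. indicator B v * measure M (A \<inter> {x - v<..x - v + c}))"
proof -
  let ?S = "{(u, v). u \<in> A \<and> v \<in> B \<and> x < u + v \<and> u + v \<le> x + c}"
  have slice: "(\<lambda>u. (u, v)) -` ?S = (if v \<in> B then A \<inter> {x - v<..x - v + c} else {})" for v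
    by auto
  have meas: "(\<lambda>v. measure M ((\<lambda>u. (u, v)) -` ?S)) \<in> borel_measurable N"
    unfolding measure_def
    by (intro borel_measurable_enn2real measurable_emeasure_Pair2 strip_sets assms)
  have eq: "measure M ((\<lambda>u. (u, v)) -` ?S) = indicator B v * measure M (A \<inter> {x - v<..x - v + c})" for v
    unfolding slice by simp
  show int: "integrable N (\<lambda>v. indicator B v * measure M (A \<inter> {x - v<..x - v + c}))"
    using meas unfolding eq
    by (intro N.integrable_const_bound[where B = 1]) (auto simp: indicator_def)
  have "emeasure (M \<Otimes>\<^sub>M N) ?S = (\<integral>\<^sup>+v. emeasure M ((\<lambda>u. (u, v)) -` ?S) \<partial>N)"
    by (rule emeasure_pair_measure_alt2) (rule strip_sets; fact)
  also have "\<dots> = (\<integral>\<^sup>+v. ennreal (indicator B v * measure M (A \<inter> {x - v<..x - v + c})) \<partial>N)"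
    by (simp only: M.emeasure_eq_measure eq)
  also have "\<dots> = ennreal (\<integral>v. indicator B v * measure M (A \<inter> {x - v<..x - v + c}) \<partial>N)"
    by (rule nn_integral_eq_integral[OF int]) simp
  finally show "conv_on c M N A B x = (\<integral>v. indicator B v * measure M (A \<inter> {x - v<..x - v + c}) \<partial>N)"
    unfolding conv_on_def measure_def by (simp add: integral_nonneg_AE)
qed

lemma delta_prob_convolution: "delta_prob c (convolution M N) x = conv_on c M N UNIV UNIV x"
proof -
  have [measurable]: "(\<lambda>(u, v). u + v) \<in> M \<Otimes>\<^sub>M N \<rightarrow>\<^sub>M (borel :: real measure)"
    unfolding measurable_cong_sets[OF sets_pair refl] by measurable
  show ?thesis
    unfolding delta_prob_def convolution_def conv_on_def
    by (subst measure_distr) (auto simp: space_pair_measure intro!: arg_cong[where f = "measure _"])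
qed

lemma conv_on_mono:
  assumes [measurable]: "A' \<in> sets borel" "B' \<in> sets borel" and "A \<subseteq> A'" "B \<subseteq> B'"
  shows "conv_on c M N A B x \<le> conv_on c M N A' B' x"
  unfolding conv_on_def
  by (intro finite_measure_mono strip_sets) (use assms in auto)

text \<open>
  Dominated convergence: after division by \<open>M(x + \<Delta>)\<close> the integrand \<open>M(x - v + \<Delta>)\<close> tends to
  \<open>1\<close> for every \<open>v\<close>, by long-tailedness.
\<close>

lemma conv_on_UNIV_tendsto:
  assumes L: "delta_prob c M \<in> class_L"
    and B [measurable]: "B \<in> sets borel"
    and dom: "eventually (\<lambda>x. AE v in N. v \<in> B \<longrightarrow> delta_prob c M (x - v) \<le> K * delta_prob c M x) at_top"
  shows "((\<lambda>x. conv_on c M N UNIV B x / delta_prob c M x) \<longlongrightarrow> measure N B) at_top"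
proof -
  have [measurable]: "delta_prob c M \<in> borel_measurable borel"
    by (rule M.delta_prob_measurable)
  have "((\<lambda>x. \<integral>v. indicator B v * (delta_prob c M (x - v) / delta_prob c M x) \<partial>N)
      \<longlongrightarrow> (\<integral>v. indicator B v \<partial>N)) at_top"
  proof (rule integral_dominated_convergence_at_top[where w = "\<lambda>_. \<bar>K\<bar>"])
    show "AE v in N. ((\<lambda>x. indicator B v * (delta_prob c M (x - v) / delta_prob c M x))
        \<longlongrightarrow> indicator B v) at_top"
    proof (rule AE_I2)
      fix v
      show "((\<lambda>x. indicator B v * (delta_prob c M (x - v) / delta_prob c M x))
        \<longlongrightarrow> indicator B v) at_top"
        using tendsto_mult[OF tendsto_const[of "indicator B v"] class_L_shift[OF L, of v]] by simp
    qed
    show "\<forall>\<^sub>F x in at_top. AE v in N.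
        norm (indicator B v * (delta_prob c M (x - v) / delta_prob c M x)) \<le> \<bar>K\<bar>"
      using dom class_L_eventually_pos[OF L]
    proof eventually_elim
      case (elim x)
      from elim(1) show ?case
      proof eventually_elim
        case (elim v)
        have "delta_prob c M (x - v) \<le> \<bar>K\<bar> * delta_prob c M x" if "v \<in> B"
          using elim that mult_right_mono[OF abs_ge_self[of K] delta_prob_nonneg[of c M x]]
          by simp
        then show ?case
          using \<open>0 < delta_prob c M x\<close> by (simp add: indicator_def divide_le_eq)
      qed
    qed
  qed simp_all
  moreover have "conv_on c M N UNIV B x / delta_prob c M x
      = (\<integral>v. indicator B v * (delta_prob c M (x - v) / delta_prob c M x) \<partial>N)" for x
    by (simp add: conv_on_eq_integral(1) delta_prob_def)
  moreover have "(\<integral>v. indicator B v \<partial>N) = measure N B" by simp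
  ultimately show ?thesis by (simp only:)
qed

end

text \<open>
  Fix the value \<open>v\<close> of the second summand. Then the first ranges over \<open>t + \<Delta>\<close> with \<open>t = x - v\<close>, and this
  interval meets \<open>(h, \<infinity>)\<close> only if \<open>t > h - c\<close>. So the comparison of local probabilities is
  used only beyond \<open>h - c\<close>, and there all of \<open>t + \<Delta>\<close> lies in \<open>(h - c, \<infinity>)\<close>.
\<close>

lemma conv_on_compare:
  assumes "real_distribution M" "real_distribution M'" "real_distribution N"
    and B [measurable]: "B \<in> sets borel"
    and le: "\<And>t. t \<ge> h - c \<Longrightarrow> delta_prob c M t \<le> C * delta_prob c M' t" and C: "C \<ge> 0"
  shows "conv_on c M N {h<..} B x \<le> C * conv_on c M' N {h - c<..} B x"
proof -
  interpret M: real_distribution M by fact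
  interpret M': real_distribution M' by fact
  interpret N: real_distribution N by fact
  interpret MN: real_distribution_pair M N ..
  interpret M'N: real_distribution_pair M' N ..
  have "measure M ({h<..} \<inter> {t<..t + c}) \<le> C * measure M' ({h - c<..} \<inter> {t<..t + c})" for t
  proof (cases "t \<ge> h - c")
    case True
    then have "{h - c<..} \<inter> {t<..t + c} = {t<..t + c}" by auto
    moreover have "measure M ({h<..} \<inter> {t<..t + c}) \<le> measure M {t<..t + c}"
      by (rule M.finite_measure_mono) auto
    ultimately show ?thesis using le[OF True] by (simp add: delta_prob_def)
  next
    case False
    then have "{h<..} \<inter> {t<..t + c} = {}" by auto
    then show ?thesis using C by simp
  qed
  then have "(\<integral>v. indicator B v * measure M ({h<..} \<inter> {x - v<..x - v + c}) \<partial>N)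
      \<le> (\<integral>v. C * (indicator B v * measure M' ({h - c<..} \<inter> {x - v<..x - v + c})) \<partial>N)"
    by (intro integral_mono MN.conv_on_eq_integral(2) integrable_mult_right M'N.conv_on_eq_integral(2))
      (auto simp: indicator_def)
  then show ?thesis
    by (simp add: MN.conv_on_eq_integral(1) M'N.conv_on_eq_integral(1))
qed

lemma conv_on_tails_compare:
  assumes F: "real_distribution F" and G: "real_distribution G"
    and le: "\<And>t. t \<ge> h - c \<Longrightarrow> delta_prob c G t \<le> C * delta_prob c F t" and C: "C \<ge> 0"
  shows "conv_on c G G {h<..} {h<..} x \<le> C\<^sup>2 * conv_on c F F {h - c<..} {h - c<..} x"
proof -
  interpret F: real_distribution F by fact
  interpret G: real_distribution G by fact
  interpret FG: real_distribution_pair F G ..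
  have "conv_on c G G {h<..} {h<..} x \<le> C * conv_on c F G {h - c<..} {h<..} x"
    by (rule conv_on_compare[OF G F G _ le C]) auto
  also have "conv_on c F G {h - c<..} {h<..} x = conv_on c G F {h<..} {h - c<..} x"
    by (rule FG.conv_on_swap) auto
  also have "\<dots> \<le> C * conv_on c F F {h - c<..} {h - c<..} x"
    by (rule conv_on_compare[OF G F F _ le C]) auto
  finally show ?thesis using C by (simp add: power2_eq_square mult_left_mono)
qed

text \<open>
  The bound \<open>x \<ge> 2 h\<close> excludes that both summands are at most \<open>h\<close> while their sum exceeds \<open>x\<close>.
\<close>

lemma delta_prob_convolution_split:
  assumes "real_distribution F" and "x \<ge> 2 * h"
  shows "delta_prob c (convolution F F) x
    = 2 * conv_on c F F UNIV {..h} x + conv_on c F F {h<..} {h<..} x"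
proof -
  interpret F: real_distribution F by fact
  interpret FF: real_distribution_pair F F ..
  define S where "S A B = {(u, v). u \<in> A \<and> v \<in> B \<and> x < u + v \<and> u + v \<le> x + c}" for A B
  have S [measurable]: "S A B \<in> sets (F \<Otimes>\<^sub>M F)" if "A \<in> sets borel" "B \<in> sets borel" for A B
    unfolding S_def by (rule FF.strip_sets) fact+
  have "S UNIV UNIV = (S UNIV {..h} \<union> S {..h} UNIV) \<union> S {h<..} {h<..}"
    by (auto simp: S_def)
  moreover have "(S UNIV {..h} \<union> S {..h} UNIV) \<inter> S {h<..} {h<..} = {}"
    and "S UNIV {..h} \<inter> S {..h} UNIV = {}"
    using assms by (auto simp: S_def)
  ultimately have "measure (F \<Otimes>\<^sub>M F) (S UNIV UNIV) = measure (F \<Otimes>\<^sub>M F) (S UNIV {..h})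
      + measure (F \<Otimes>\<^sub>M F) (S {..h} UNIV) + measure (F \<Otimes>\<^sub>M F) (S {h<..} {h<..})"
    using FF.finite_measure_Union[of "S UNIV {..h} \<union> S {..h} UNIV" "S {h<..} {h<..}"]
      FF.finite_measure_Union[of "S UNIV {..h}" "S {..h} UNIV"]
      S[of UNIV "{..h}"] S[of "{..h}" UNIV] S[of "{h<..}" "{h<..}"]
    by (simp del: FF.sets_pair)
  moreover have "conv_on c F F A B x = measure (F \<Otimes>\<^sub>M F) (S A B)" for A B
    by (simp add: conv_on_def S_def)
  ultimately show ?thesis
    using FF.conv_on_swap[of "{..h}" UNIV c x] by (simp add: FF.delta_prob_convolution)
qed

section \<open>Local subexponentiality as negligibility of two large summands\<close>

lemma S_delta_iff_ratio:
  assumes "F \<in> L_delta c"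
  shows "F \<in> S_delta c \<longleftrightarrow>
    ((\<lambda>x. delta_prob c (convolution F F) x / delta_prob c F x) \<longlongrightarrow> 2) at_top"
proof -
  have pos: "eventually (\<lambda>x. 0 < 2 * delta_prob c F x) at_top"
    using class_L_eventually_pos[of "delta_prob c F"] assms by (simp add: L_delta_def)
  have "((\<lambda>x. delta_prob c (convolution F F) x / (2 * delta_prob c F x)) \<longlongrightarrow> 1) at_top \<longleftrightarrow>
      ((\<lambda>x. delta_prob c (convolution F F) x / delta_prob c F x) \<longlongrightarrow> 2) at_top"
    using tendsto_mult_left_iff[of "2::real" "\<lambda>x. delta_prob c (convolution F F) x / (2 * delta_prob c F x)" 1]
    by simp
  then show ?thesis
    using assms asymp_equiv_iff_ratio[OF pos] by (simp add: S_delta_def)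
qed

text \<open>
  The whole convolution has relative size \<open>2\<close> in the limit, and the parts with one summand in
  \<open>(-h, h]\<close> already account for \<open>2 F((-h, h])\<close>. Two large summands are left with at most
  \<open>2 - 2 F((-h, h])\<close>, which tends to \<open>0\<close>. Very negative summands, for which
  \<open>F(x - v + \<Delta>) / F(x + \<Delta>)\<close> may be unbounded, are simply discarded.
\<close>

lemma S_delta_tails_negligible:
  assumes c: "c > 0" and F: "F \<in> S_delta c" and \<epsilon>: "\<epsilon> > 0"
  shows "eventually (\<lambda>h. eventually
    (\<lambda>x. conv_on c F F {h<..} {h<..} x \<le> \<epsilon> * delta_prob c F x) at_top) at_top"
proof -
  have FL: "F \<in> L_delta c" and L: "delta_prob c F \<in> class_L"
    using F by (auto simp: S_delta_def L_delta_def)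
  interpret real_distribution F using FL by (simp add: L_delta_def)
  interpret FF: real_distribution_pair F F ..
  have "((\<lambda>h. 1 - cdf F h + cdf F (- h)) \<longlongrightarrow> 1 - 1 + 0) at_top"
    by (intro tendsto_intros cdf_lim_at_top_prob
        filterlim_compose[OF cdf_lim_at_bot filterlim_uminus_at_bot_at_top])
  then have "eventually (\<lambda>h. 1 - cdf F h + cdf F (- h) < \<epsilon> / 2) at_top"
    by (rule order_tendstoD(2)) (use \<epsilon> in simp)
  with eventually_gt_at_top[of 0] show ?thesis
  proof eventually_elim
    case (elim h)
    have meas: "measure F {-h<..h} = cdf F h - cdf F (-h)"
      using cdf_diff_eq[of "-h" h] elim by simp
    have "((\<lambda>x. conv_on c F F UNIV {-h<..h} x / delta_prob c F x) \<longlongrightarrow> measure F {-h<..h}) at_top"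
    proof (rule FF.conv_on_UNIV_tendsto[OF L])
      show "eventually (\<lambda>x. AE v in F. v \<in> {-h<..h} \<longrightarrow>
          delta_prob c F (x - v) \<le> 4 * delta_prob c F x) at_top"
        using delta_prob_locally_bounded[OF c FL, of h] by eventually_elim auto
    qed simp
    moreover have "((\<lambda>x. delta_prob c (convolution F F) x / delta_prob c F x) \<longlongrightarrow> 2) at_top"
      using F S_delta_iff_ratio[OF FL] by simp
    ultimately have "((\<lambda>x. delta_prob c (convolution F F) x / delta_prob c F x
        - 2 * (conv_on c F F UNIV {-h<..h} x / delta_prob c F x))
        \<longlongrightarrow> 2 - 2 * measure F {-h<..h}) at_top"
      by (intro tendsto_intros)
    moreover have "2 - 2 * measure F {-h<..h} < \<epsilon>" using elim meas by simp
    ultimately have "eventually (\<lambda>x. delta_prob c (convolution F F) x / delta_prob c F x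
        - 2 * (conv_on c F F UNIV {-h<..h} x / delta_prob c F x) < \<epsilon>) at_top"
      by (rule order_tendstoD(2))
    with class_L_eventually_pos[OF L] eventually_ge_at_top[of "2 * h"] show ?case
    proof eventually_elim
      case (elim x)
      have "conv_on c F F UNIV {-h<..h} x \<le> conv_on c F F UNIV {..h} x"
        by (rule FF.conv_on_mono) auto
      then have "conv_on c F F {h<..} {h<..} x
          \<le> delta_prob c (convolution F F) x - 2 * conv_on c F F UNIV {-h<..h} x"
        using delta_prob_convolution_split[OF real_distribution_axioms \<open>2 * h \<le> x\<close>, of c] by simp
      also have "\<dots> \<le> \<epsilon> * delta_prob c F x"
        using elim by (simp add: field_simps)
      finally show ?case .
    qed
  qed
qed

text \<open>
  Here the limit of the convolution has to be bounded from above, so all of \<open>(-\<infinity>, h]\<close> must be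
  treated by dominated convergence: on \<open>[-h, h]\<close> through local boundedness, and on the negative
  half-line through the assumption \<open>left\<close>.
\<close>

lemma S_deltaI_tails_negligible:
  assumes c: "c > 0" and G: "G \<in> L_delta c"
    and left: "eventually (\<lambda>x. AE v in G. v \<le> 0 \<longrightarrow>
          delta_prob c G (x - v) \<le> K * delta_prob c G x) at_top"
    and tails: "\<And>\<epsilon>. \<epsilon> > 0 \<Longrightarrow> eventually (\<lambda>h. eventually
        (\<lambda>x. conv_on c G G {h<..} {h<..} x \<le> \<epsilon> * delta_prob c G x) at_top) at_top"
  shows "G \<in> S_delta c"
proof -
  have L: "delta_prob c G \<in> class_L"
    using G by (auto simp: L_delta_def)
  interpret real_distribution G using G by (simp add: L_delta_def)
  interpret GG: real_distribution_pair G G ..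
  have head: "((\<lambda>x. conv_on c G G UNIV {..h} x / delta_prob c G x) \<longlongrightarrow> cdf G h) at_top" for h
    unfolding cdf_def
  proof (rule GG.conv_on_UNIV_tendsto[OF L])
    show "eventually (\<lambda>x. AE v in G. v \<in> {..h} \<longrightarrow>
        delta_prob c G (x - v) \<le> max 4 K * delta_prob c G x) at_top"
      using left delta_prob_locally_bounded[OF c G, of h]
    proof eventually_elim
      case (elim x)
      note local = elim(2)
      from elim(1) show ?case
      proof eventually_elim
        case (elim v)
        have *: "delta_prob c G (x - v) \<le> max 4 K * delta_prob c G x"
          if "delta_prob c G (x - v) \<le> k * delta_prob c G x" "k \<le> max 4 K" for k
          using that by (meson delta_prob_nonneg mult_right_mono order_trans)
        show ?case
        proof
          assume "v \<in> {..h}"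
          then consider "v \<le> 0" | "v \<in> {-h..h}" by force
          then show "delta_prob c G (x - v) \<le> max 4 K * delta_prob c G x"
            proof cases
            case 1
            show ?thesis by (rule *[of K]) (use elim 1 in simp_all)
          next
            case 2
            show ?thesis by (rule *[of 4]) (use local 2 in simp_all)
          qed
        qed
      qed
    qed
  qed simp
  have "((\<lambda>x. delta_prob c (convolution G G) x / delta_prob c G x) \<longlongrightarrow> 2) at_top"
  proof (rule tendstoI)
    fix e :: real assume e: "e > 0"
    \<comment> \<open>The ratio is \<open>2 a + b\<close> with \<open>a\<close> within \<open>e / 4\<close> of \<open>1\<close> and \<open>0 \<le> b \<le> e / 4\<close>.\<close>
    have "eventually (\<lambda>h. 1 - e / 8 < cdf G h) at_top"
      by (rule order_tendstoD(1)[OF cdf_lim_at_top_prob]) (use e in simp)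
    moreover have "eventually (\<lambda>h. eventually
        (\<lambda>x. conv_on c G G {h<..} {h<..} x \<le> e / 4 * delta_prob c G x) at_top) at_top"
      by (rule tails) (use e in simp)
    ultimately have "eventually (\<lambda>h. 1 - e / 8 < cdf G h \<and> eventually
        (\<lambda>x. conv_on c G G {h<..} {h<..} x \<le> e / 4 * delta_prob c G x) at_top) at_top"
      by (rule eventually_conj)
    then obtain h where h: "1 - e / 8 < cdf G h"
      and tail: "eventually (\<lambda>x. conv_on c G G {h<..} {h<..} x \<le> e / 4 * delta_prob c G x) at_top"
      using eventually_happens'[OF trivial_limit_at_top_linorder] by blast
    have "eventually (\<lambda>x. dist (conv_on c G G UNIV {..h} x / delta_prob c G x) (cdf G h) < e / 8) at_top"
      by (rule tendstoD[OF head]) (use e in simp)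
    with tail class_L_eventually_pos[OF L] eventually_ge_at_top[of "2 * h"]
    show "eventually (\<lambda>x. dist (delta_prob c (convolution G G) x / delta_prob c G x) 2 < e) at_top"
    proof eventually_elim
      case (elim x)
      define a where "a = conv_on c G G UNIV {..h} x / delta_prob c G x"
      define b where "b = conv_on c G G {h<..} {h<..} x / delta_prob c G x"
      have "delta_prob c (convolution G G) x / delta_prob c G x = 2 * a + b"
        unfolding delta_prob_convolution_split[OF real_distribution_axioms elim(3)] a_def b_def
        by (simp add: add_divide_distrib)
      moreover have "\<bar>a - cdf G h\<bar> < e / 8"
        using elim(4) by (simp add: a_def dist_real_def)
      moreover have "0 \<le> b" "b \<le> e / 4"
        using elim(1,2) by (simp_all add: b_def conv_on_def field_simps)
      moreover note h cdf_bounded_prob[of h] e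
      ultimately show ?case unfolding dist_real_def abs_less_iff by linarith
    qed
  qed
  then show ?thesis using S_delta_iff_ratio[OF G] by simp
qed

section \<open>Transfer between weakly equivalent distributions\<close>

lemma weakly_equivE:
  assumes "\<alpha> \<asymp> \<beta>" and "eventually (\<lambda>x. 0 < \<beta> x) at_top"
  obtains a C where "a > 0" "C > 0" "eventually (\<lambda>x. a * \<beta> x \<le> \<alpha> x \<and> \<alpha> x \<le> C * \<beta> x) at_top"
proof -
  from assms(1) have "0 < Liminf at_top (\<lambda>x. ereal (\<alpha> x / \<beta> x))"
    and "Limsup at_top (\<lambda>x. ereal (\<alpha> x / \<beta> x)) < \<infinity>"
    by (auto simp: weakly_equiv_def)
  then obtain a C where a: "0 < ereal a" "ereal a < Liminf at_top (\<lambda>x. ereal (\<alpha> x / \<beta> x))"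
    and C: "Limsup at_top (\<lambda>x. ereal (\<alpha> x / \<beta> x)) < ereal C"
    using ereal_dense2 by (meson less_ereal.simps)
  have "eventually (\<lambda>x. a * \<beta> x \<le> \<alpha> x \<and> \<alpha> x \<le> max 1 C * \<beta> x) at_top"
    using less_LiminfD[OF a(2)] Limsup_lessD[OF C] assms(2)
  proof eventually_elim
    case (elim x)
    have "a * \<beta> x \<le> \<alpha> x" "\<alpha> x \<le> C * \<beta> x"
      using elim by (simp_all add: divide_less_eq less_divide_eq)
    moreover have "C * \<beta> x \<le> max 1 C * \<beta> x"
      using elim by (intro mult_right_mono) auto
    ultimately show ?case by (blast intro: order_trans)
  qed
  then show ?thesis using that[of a "max 1 C"] a(1) by simp
qed

lemma weakly_equiv_of_asymp_equiv:
  assumes "\<kappa> > 0" and "eventually (\<lambda>x. 0 < \<beta> x) at_top"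
    and "\<alpha> \<sim>[at_top] (\<lambda>x. \<kappa> * \<beta> x)"
  shows "\<alpha> \<asymp> \<beta>"
proof -
  have pos: "eventually (\<lambda>x. 0 < \<kappa> * \<beta> x) at_top"
    using assms(2) by eventually_elim (use assms(1) in simp)
  have "((\<lambda>x. \<kappa> * (\<alpha> x / (\<kappa> * \<beta> x))) \<longlongrightarrow> \<kappa> * 1) at_top"
    by (intro tendsto_intros) (use assms(3) asymp_equiv_iff_ratio[OF pos] in simp)
  then have lim: "((\<lambda>x. ereal (\<alpha> x / \<beta> x)) \<longlongrightarrow> ereal \<kappa>) at_top"
    using assms(1) by simp
  show ?thesis
    using assms(1) lim_imp_Liminf[OF _ lim] lim_imp_Limsup[OF _ lim] by (simp add: weakly_equiv_def)
qed

lemma class_L_asymp_equiv: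
  assumes \<beta>: "\<beta> \<in> class_L" and "\<kappa> > 0" and equiv: "\<alpha> \<sim>[at_top] (\<lambda>x. \<kappa> * \<beta> x)"
    and "\<alpha> \<in> borel_measurable borel" and nonneg: "\<And>x. 0 \<le> \<alpha> x"
  shows "\<alpha> \<in> class_L"
proof -
  have "eventually (\<lambda>x. 0 < \<alpha> x) at_top"
    using asymp_equiv_eventually_zeros[OF equiv] class_L_eventually_pos[OF \<beta>]
    by eventually_elim (use nonneg \<open>\<kappa> > 0\<close> in \<open>auto simp: less_le\<close>)
  then obtain x0 where "\<And>x. x \<ge> x0 \<Longrightarrow> 0 < \<alpha> x"
    by (auto simp: eventually_at_top_linorder)
  then have pos: "\<exists>x0>0. \<forall>x\<ge>x0. 0 < \<alpha> x"
    by (intro exI[of _ "max 1 x0"]) auto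
  have "(\<lambda>x. \<alpha> (x + y)) \<sim>[at_top] \<alpha>" if "y > 0" for y
  proof -
    from asymp_equiv_compose'[OF equiv filterlim_shift_at_top[of y]]
    have "(\<lambda>x. \<alpha> (x + y)) \<sim>[at_top] (\<lambda>x. \<kappa> * \<beta> (x + y))" .
    also have "(\<lambda>x. \<kappa> * \<beta> (x + y)) \<sim>[at_top] (\<lambda>x. \<kappa> * \<beta> x)"
      using \<beta> that by (intro asymp_equiv_intros) (simp add: class_L_def)
    also have "\<dots> \<sim>[at_top] \<alpha>" using equiv by (rule asymp_equiv_symI)
    finally show ?thesis .
  qed
  then show ?thesis using assms pos by (simp add: class_L_def)
qed

lemma S_delta_transfer:
  assumes c: "c > 0" and F: "F \<in> S_delta c" and G: "G \<in> L_delta c"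
    and equiv: "delta_prob c G \<asymp> delta_prob c F"
    and left: "eventually (\<lambda>x. AE v in G. v \<le> 0 \<longrightarrow>
          delta_prob c G (x - v) \<le> K * delta_prob c G x) at_top"
  shows "G \<in> S_delta c"
proof (rule S_deltaI_tails_negligible[OF c G left])
  have "F \<in> L_delta c" using F by (simp add: S_delta_def)
  then have dF: "real_distribution F" and L: "delta_prob c F \<in> class_L"
    by (auto simp: L_delta_def)
  have dG: "real_distribution G" using G by (simp add: L_delta_def)
  obtain a C where a: "a > 0" and C: "C > 0"
    and ev: "eventually (\<lambda>x. a * delta_prob c F x \<le> delta_prob c G x
        \<and> delta_prob c G x \<le> C * delta_prob c F x) at_top"
    using weakly_equivE[OF equiv class_L_eventually_pos[OF L]] by metis
  then obtain x0 where le: "\<And>t. t \<ge> x0 \<Longrightarrow> delta_prob c G t \<le> C * delta_prob c F t"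
    by (auto simp: eventually_at_top_linorder)
  fix \<epsilon> :: real assume \<epsilon>: "\<epsilon> > 0"
  \<comment> \<open>The factor \<open>C\<^sup>2\<close> is lost in passing from \<open>G\<close> to \<open>F\<close> in both summands, and \<open>a\<close> in returning
      from \<open>F(x + \<Delta>)\<close> to \<open>G(x + \<Delta>)\<close>.\<close>
  let ?\<delta> = "\<epsilon> * a / C\<^sup>2"
  have "filterlim (\<lambda>h. h - c) at_top at_top"
    using filterlim_shift_at_top[of "- c"] by simp
  then have "eventually (\<lambda>h. eventually (\<lambda>x. conv_on c F F {h - c<..} {h - c<..} x
      \<le> ?\<delta> * delta_prob c F x) at_top) at_top"
    by (rule eventually_compose_filterlim[rotated])
      (rule S_delta_tails_negligible[OF c F], use \<epsilon> a C in simp)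
  with eventually_ge_at_top[of "x0 + c"]
  show "eventually (\<lambda>h. eventually
      (\<lambda>x. conv_on c G G {h<..} {h<..} x \<le> \<epsilon> * delta_prob c G x) at_top) at_top"
  proof eventually_elim
    case (elim h)
    from elim(2) ev show ?case
    proof eventually_elim
      case (elim x)
      have "conv_on c G G {h<..} {h<..} x \<le> C\<^sup>2 * conv_on c F F {h - c<..} {h - c<..} x"
        by (rule conv_on_tails_compare[OF dF dG]) (use le C \<open>x0 + c \<le> h\<close> in auto)
      also have "\<dots> \<le> C\<^sup>2 * (?\<delta> * delta_prob c F x)"
        using elim by (intro mult_left_mono) auto
      also have "\<dots> = \<epsilon> * (a * delta_prob c F x)" using C by simp
      also have "\<dots> \<le> \<epsilon> * delta_prob c G x"
        using elim \<epsilon> by (intro mult_left_mono) auto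
      finally show ?case .
    qed
  qed
qed

text \<open>
  For \<open>v < 0\<close> the interval moves to the right, where almost-decrease of \<open>F\<close> applies; weak
  equivalence, used once at \<open>x - v\<close> and once at \<open>x\<close>, carries the bound over to \<open>G\<close>.
\<close>

lemma left_domination_of_D_delta:
  assumes F: "F \<in> D_delta c" and pos: "eventually (\<lambda>x. 0 < delta_prob c F x) at_top"
    and equiv: "delta_prob c G \<asymp> delta_prob c F"
  shows "\<exists>K. eventually (\<lambda>x. \<forall>v\<le>0. delta_prob c G (x - v) \<le> K * delta_prob c G x) at_top"
proof -
  obtain a C where a: "a > 0" and C: "C > 0"
    and ev: "eventually (\<lambda>x. a * delta_prob c F x \<le> delta_prob c G x
        \<and> delta_prob c G x \<le> C * delta_prob c F x) at_top"
    using weakly_equivE[OF equiv pos] by metis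
  then obtain x1 where x1: "\<And>t. t \<ge> x1 \<Longrightarrow> a * delta_prob c F t \<le> delta_prob c G t"
      "\<And>t. t \<ge> x1 \<Longrightarrow> delta_prob c G t \<le> C * delta_prob c F t"
    by (auto simp: eventually_at_top_linorder)
  obtain x0 K where K: "K > 0" "\<And>x y. x > x0 \<Longrightarrow> y > 0 \<Longrightarrow> delta_prob c F (x + y) \<le> K * delta_prob c F x"
    using F by (auto simp: D_delta_def almost_decreasing_def)
  have "eventually (\<lambda>x. \<forall>v\<le>0. delta_prob c G (x - v) \<le> (C * max 1 K / a) * delta_prob c G x) at_top"
    using eventually_gt_at_top[of x0] eventually_ge_at_top[of x1]
  proof eventually_elim
    case (elim x)
    show ?case
    proof (intro allI impI)
      fix v :: real assume v: "v \<le> 0"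
      have "delta_prob c F (x - v) \<le> max 1 K * delta_prob c F x"
      proof (cases "v = 0")
        case True
        then show ?thesis
          using mult_right_mono[of 1 "max 1 K" "delta_prob c F x"] by simp
      next
        case False
        then have "delta_prob c F (x - v) \<le> K * delta_prob c F x"
          using K(2)[of x "-v"] v elim by simp
        also have "\<dots> \<le> max 1 K * delta_prob c F x" by (rule mult_right_mono) auto
        finally show ?thesis .
      qed
      then have "C * delta_prob c F (x - v) \<le> C * (max 1 K * delta_prob c F x)"
        using C by (intro mult_left_mono) auto
      moreover have "delta_prob c G (x - v) \<le> C * delta_prob c F (x - v)"
        using x1(2)[of "x - v"] elim v by simp
      moreover have "(C * max 1 K / a) * (a * delta_prob c F x) \<le> (C * max 1 K / a) * delta_prob c G x"
        using x1(1)[of x] elim a C by (intro mult_left_mono) auto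
      ultimately show "delta_prob c G (x - v) \<le> (C * max 1 K / a) * delta_prob c G x"
        using a by (simp add: mult.assoc)
    qed
  qed
  then show ?thesis by blast
qed

theorem proposition3p7:
  fixes c :: real and F G :: "real measure"
  assumes "c > 0" and "real_distribution F" and "real_distribution G"
  shows
    "(F \<in> S_delta c \<inter> D_delta c \<and> G \<in> L_delta c \<and> delta_prob c G \<asymp> delta_prob c F
        \<longrightarrow> G \<in> S_delta c) \<and>
     (\<forall>\<kappa>>0. F \<in> S_delta c \<inter> D_delta c \<and>
        delta_prob c G \<sim>[at_top] (\<lambda>x. \<kappa> * delta_prob c F x)
        \<longrightarrow> G \<in> S_delta c) \<and>
     ((AE x in G. 0 \<le> x) \<longrightarrow>
        (F \<in> S_delta c \<and> G \<in> L_delta c \<and> delta_prob c G \<asymp> delta_prob c F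
           \<longrightarrow> G \<in> S_delta c) \<and>
        (\<forall>\<kappa>>0. F \<in> S_delta c \<and>
           delta_prob c G \<sim>[at_top] (\<lambda>x. \<kappa> * delta_prob c F x)
           \<longrightarrow> G \<in> S_delta c))"
proof -
  have L: "delta_prob c F \<in> class_L" if "F \<in> S_delta c"
    using that by (simp add: S_delta_def L_delta_def)
  have weak: "G \<in> L_delta c \<and> delta_prob c G \<asymp> delta_prob c F"
    if "F \<in> S_delta c" "\<kappa> > 0" "delta_prob c G \<sim>[at_top] (\<lambda>x. \<kappa> * delta_prob c F x)" for \<kappa>
    using class_L_asymp_equiv[OF L that(2,3) real_distribution.delta_prob_measurable]
      weakly_equiv_of_asymp_equiv[OF that(2) class_L_eventually_pos[OF L] that(3)] that(1) assms(3)
    by (simp add: L_delta_def)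
  have decreasing: "G \<in> S_delta c"
    if FS: "F \<in> S_delta c" and FD: "F \<in> D_delta c"
      and GL: "G \<in> L_delta c" and equiv: "delta_prob c G \<asymp> delta_prob c F"
  proof -
    obtain K where "eventually (\<lambda>x. \<forall>v\<le>0. delta_prob c G (x - v) \<le> K * delta_prob c G x) at_top"
      using left_domination_of_D_delta[OF FD class_L_eventually_pos[OF L[OF FS]] equiv]
      by blast
    then have "eventually (\<lambda>x. AE v in G. v \<le> 0 \<longrightarrow>
        delta_prob c G (x - v) \<le> K * delta_prob c G x) at_top"
      by eventually_elim auto
    then show ?thesis by (rule S_delta_transfer[OF assms(1) FS GL equiv])
  qed
  have nonneg: "G \<in> S_delta c"
    if "AE x in G. 0 \<le> x" "F \<in> S_delta c" "G \<in> L_delta c" "delta_prob c G \<asymp> delta_prob c F"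
  proof (rule S_delta_transfer[OF assms(1) that(2-4)])
    \<comment> \<open>Almost surely \<open>v \<le> 0\<close> forces \<open>v = 0\<close>.\<close>
    have "AE v in G. v \<le> 0 \<longrightarrow> delta_prob c G (x - v) \<le> 1 * delta_prob c G x" for x
      using that(1) by eventually_elim auto
    then show "eventually (\<lambda>x. AE v in G. v \<le> 0 \<longrightarrow>
        delta_prob c G (x - v) \<le> 1 * delta_prob c G x) at_top"
      by (rule eventually_mono[OF eventually_True])
  qed
  show ?thesis
    using weak decreasing nonneg by blast
qed

end
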